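(* Let $L\ge 0$ be an integer, $\sigma_b^2>0$, $0<\sigma_w^2<1$, $\Delta_w=1-\sigma_w^2$. Consider the quadratic energy of fluctuations $\epsilon=(\epsilon^0,\dots,\epsilon^L)\in\mathbb R^{L+1}$, with $\epsilon^{-1}=\epsilon^L$, $$U(\{\epsilon^l\})=\frac{\Delta_w}{\sigma_b^2}\sum_{l=0}^L\left[(1+\sigma_w^4)(\epsilon^l)^2-2\sigma_w^2\epsilon^l\epsilon^{l-1}\right].$$ Writing $\epsilon^l=\sum_q\epsilon_qe^{-iql}$, where $q$ runs over $q=2\pi n/(L+1)$, $n=0,\dots,L$, one has $$U=\frac{(L+1)\Delta_w}{\sigma_b^2}\sum_q\left\{(1+\sigma_w^4)-2\sigma_w^2\cos q\right\}|\epsilon_q|^2 .$$ Consequently, under the probability distribution on $\mathbb R^{L+1}$ with density proportional to $e^{-U}$, the Fourier modes $\epsilon_q$ are jointly Gaussian and the distribution factorizes over modes: they are uncoupled (independent) Gaussian random variables, apart from the reality constraint $\epsilon_{-q}=\overline{\epsilon_q}$ (with $-q$ taken modulo $2\pi$).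
   Context: The superscript $l$ in $\epsilon^l$ is a layer index, not a power; $\sigma_w^4=(\sigma_w^2)^2$. $U$ is the quadratic-order energy, relative to the minimum, of small fluctuations $r^l=r^*+\epsilon^l$ of the norms of pre-activations in the stochastic linear network on a ring with $L+1$ sites, about the constant minimizing configuration $r^*$. *)

theory Defs
  imports "HOL-Probability.Probability"
begin

text \<open>
  A configuration \<open>\<epsilon>\<close> in \<open>\<real>\<^bsup>L+1\<^esup>\<close> is a function on \<open>nat\<close> of which only the values at
  the sites \<open>0, \<dots>, L\<close> matter.  The cyclic convention \<open>\<epsilon>\<^bsup>-1\<^esup> = \<epsilon>\<^bsup>L\<^esup>\<close> is encoded in
  \<open>prev_site\<close>.
\<close>

definition prev_site :: "nat \<Rightarrow> nat \<Rightarrow> nat" where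
  "prev_site L l = (if l = 0 then L else l - 1)"

definition Delta_w :: "real \<Rightarrow> real" where
  "Delta_w \<sigma>w = 1 - \<sigma>w\<^sup>2"

definition energy :: "nat \<Rightarrow> real \<Rightarrow> real \<Rightarrow> (nat \<Rightarrow> real) \<Rightarrow> real" where
  "energy L \<sigma>b \<sigma>w \<epsilon> =
     Delta_w \<sigma>w / \<sigma>b\<^sup>2 *
     (\<Sum>l\<le>L. (1 + \<sigma>w ^ 4) * (\<epsilon> l)\<^sup>2 - 2 * \<sigma>w\<^sup>2 * \<epsilon> l * \<epsilon> (prev_site L l))"

definition wavenumber :: "nat \<Rightarrow> nat \<Rightarrow> real" where
  "wavenumber L n = 2 * pi * real n / real (L + 1)"

text \<open>The index of the wavenumber \<open>-q\<close> modulo \<open>2\<pi>\<close>.\<close>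

definition neg_index :: "nat \<Rightarrow> nat \<Rightarrow> nat" where
  "neg_index L n = (L + 1 - n) mod (L + 1)"

definition fourier_expansion :: "nat \<Rightarrow> (nat \<Rightarrow> real) \<Rightarrow> (nat \<Rightarrow> complex) \<Rightarrow> bool" where
  "fourier_expansion L \<epsilon> c \<longleftrightarrow>
     (\<forall>l\<le>L. complex_of_real (\<epsilon> l) =
       (\<Sum>n\<le>L. c n * exp (- (\<i> * complex_of_real (wavenumber L n * real l)))))"

text \<open>
  The coefficients given by Fourier inversion; the main theorem asserts that they are the unique
  coefficients satisfying \<open>fourier_expansion\<close>.
\<close>

definition fourier_mode :: "nat \<Rightarrow> nat \<Rightarrow> (nat \<Rightarrow> real) \<Rightarrow> complex" where
  "fourier_mode L n \<epsilon> =
     (\<Sum>l\<le>L. complex_of_real (\<epsilon> l) * exp (\<i> * complex_of_real (wavenumber L n * real l)))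
       / of_nat (L + 1)"

definition config_lborel :: "nat \<Rightarrow> (nat \<Rightarrow> real) measure" where
  "config_lborel L = (\<Pi>\<^sub>M l\<in>{..L}. lborel)"

definition partition_fun :: "nat \<Rightarrow> real \<Rightarrow> real \<Rightarrow> real" where
  "partition_fun L \<sigma>b \<sigma>w = (\<integral>\<epsilon>. exp (- energy L \<sigma>b \<sigma>w \<epsilon>) \<partial>config_lborel L)"

definition fluct_distr :: "nat \<Rightarrow> real \<Rightarrow> real \<Rightarrow> (nat \<Rightarrow> real) measure" where
  "fluct_distr L \<sigma>b \<sigma>w =
     density (config_lborel L)
       (\<lambda>\<epsilon>. ennreal (exp (- energy L \<sigma>b \<sigma>w \<epsilon>) / partition_fun L \<sigma>b \<sigma>w))"

text \<open>
  Degenerate Gaussians are admitted: the modes at \<open>q = 0\<close> and \<open>q = \<pi>\<close> are real, so their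
  imaginary parts vanish identically.
\<close>

definition gaussian_rv :: "'a measure \<Rightarrow> ('a \<Rightarrow> real) \<Rightarrow> bool" where
  "gaussian_rv M X \<longleftrightarrow>
     X \<in> borel_measurable M \<and>
     ((\<exists>\<mu> \<sigma>. 0 < \<sigma> \<and> distributed M lborel X (\<lambda>x. ennreal (normal_density \<mu> \<sigma> x))) \<or>
      (\<exists>\<mu>. AE \<omega> in M. X \<omega> = \<mu>))"

text \<open>
  Complex random variables are jointly Gaussian if their real and imaginary parts are, i.e. if
  every real linear combination of the latter is Gaussian.
\<close>

definition jointly_gaussian :: "'a measure \<Rightarrow> 'i set \<Rightarrow> ('i \<Rightarrow> 'a \<Rightarrow> complex) \<Rightarrow> bool" where
  "jointly_gaussian M I X \<longleftrightarrow>
     (\<forall>n\<in>I. X n \<in> borel_measurable M) \<and>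
     (\<forall>a b. gaussian_rv M (\<lambda>\<omega>. \<Sum>n\<in>I. a n * Re (X n \<omega>) + b n * Im (X n \<omega>)))"

end

theory Submission
  imports Defs
begin

text \<open>
  The real Hartley transform \<open>h\<^sub>n = (L + 1)\<^bsup>-1/2\<^esup> \<Sum>\<^sub>l (cos q\<^sub>n l + sin q\<^sub>n l) \<epsilon>\<^sub>l\<close> is an orthogonal involution of
  \<open>\<real>\<^bsup>L+1\<^esup>\<close>.  Since the eigenvalues of the energy are even in \<open>q\<close>, it diagonalises the energy
  over the reals, so the \<open>h\<^sub>n\<close> are independent centred Gaussians.  The mode \<open>\<epsilon>\<^sub>q\<close> is a linear
  function of the two coordinates \<open>h\<^sub>q\<close> and \<open>h\<^sub>-\<^sub>q\<close> only; sets of modes that avoid the pairs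
  \<open>q \<noteq> -q\<close> therefore depend on disjoint blocks of independent variables.
\<close>

section \<open>Lebesgue and Gaussian measure on finite products\<close>

text \<open>Because of the reality constraint the complex modes are not free coordinates; working
  with real and imaginary parts would mean choosing half of the wavenumbers and treating q = 0 and,
  for L + 1 even, q = \<pi> apart. The Hartley coordinates are exactly L + 1 real numbers for either
  parity, with no special indices. The analytic obstacle is the change of variables: the reference
  measure is a product over a function space, and its invariance under an orthogonal map is derived
  from translation invariance and the Gaussian integral, with no determinant. The normalisation then
  follows, since the image of the normalised density is a product of probability laws and images
  preserve total mass. Independence of whole families of modes is read off from that product, not
  from vanishing covariances; joint Gaussianity is a separate consequence, which has to cope with
  combinations that degenerate to constants.\<close>

lemma exp_minus_square_eq_normal_density:
  assumes "0 < a"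
  shows "exp (- (a * t\<^sup>2)) = sqrt (pi / a) * normal_density 0 (sqrt (1 / (2 * a))) t"
proof -
  \<comment> \<open>The exponent carries no factor 1/2, so the variance is 1 / (2 a).\<close>
  have "2 * pi * (sqrt (1 / (2 * a)))\<^sup>2 = pi / a" "2 * (sqrt (1 / (2 * a)))\<^sup>2 = 1 / a"
    using assms by simp_all
  then show ?thesis
    using assms unfolding normal_density_def by simp
qed

lemma nn_integral_exp_minus_square:
  assumes "0 < a"
  shows "(\<integral>\<^sup>+t. ennreal (exp (- (a * t\<^sup>2))) \<partial>lborel) = ennreal (sqrt (pi / a))"
proof -
  have "(\<integral>\<^sup>+t. ennreal (normal_density 0 (sqrt (1 / (2 * a))) t) \<partial>lborel) = 1"
    using assms by (subst nn_integral_eq_integral) simp_all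
  then show ?thesis
    using assms by (simp add: exp_minus_square_eq_normal_density ennreal_mult nn_integral_cmult)
qed

text \<open>A product measure is determined by its values on boxes. The preimage of a box under a
  shift is a box, and each side keeps its length. The restriction to \<open>I\<close> keeps the
  shifted point in the extensional space underlying the product.\<close>

lemma distr_PiM_lborel_shift:
  fixes a :: "'i \<Rightarrow> real"
  assumes [simp]: "finite I"
  shows "distr (\<Pi>\<^sub>M i\<in>I. lborel) (\<Pi>\<^sub>M i\<in>I. lborel) (\<lambda>x. \<lambda>i\<in>I. x i + a i)
    = (\<Pi>\<^sub>M i\<in>I. (lborel :: real measure))"
proof -
  interpret product_sigma_finite "\<lambda>i::'i. lborel :: real measure" ..
  have m: "(\<lambda>x. \<lambda>i\<in>I. x i + a i)
      \<in> (\<Pi>\<^sub>M i\<in>I. (lborel :: real measure)) \<rightarrow>\<^sub>M (\<Pi>\<^sub>M i\<in>I. lborel)"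
    by measurable
  show ?thesis
  proof (rule PiM_eqI)
    fix A :: "'i \<Rightarrow> real set"
    assume A: "\<And>i. i \<in> I \<Longrightarrow> A i \<in> sets lborel"
    then have A': "\<And>i. i \<in> I \<Longrightarrow> A i \<in> sets borel"
      by simp
    have shift: "emeasure lborel ((\<lambda>t. t + a i) -` A i) = emeasure lborel (A i)" if "i \<in> I" for i
    proof -
      have "emeasure lborel (A i) = emeasure (distr lborel borel ((+) (a i))) (A i)"
        by (simp add: lborel_distr_plus)
      also have "\<dots> = emeasure lborel ((\<lambda>t. t + a i) -` A i)"
        using A'[OF that] by (subst emeasure_distr) (auto simp: add.commute vimage_def)
      finally show ?thesis by simp
    qed
    have "emeasure (distr (\<Pi>\<^sub>M i\<in>I. lborel) (\<Pi>\<^sub>M i\<in>I. lborel) (\<lambda>x. \<lambda>i\<in>I. x i + a i)) (Pi\<^sub>E I A)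
        = emeasure (\<Pi>\<^sub>M i\<in>I. lborel)
           ((\<lambda>x. \<lambda>i\<in>I. x i + a i) -` (Pi\<^sub>E I A) \<inter> space (\<Pi>\<^sub>M i\<in>I. (lborel :: real measure)))"
      using A by (intro emeasure_distr m sets_PiM_I_finite) auto
    also have "(\<lambda>x. \<lambda>i\<in>I. x i + a i) -` (Pi\<^sub>E I A) \<inter> space (\<Pi>\<^sub>M i\<in>I. (lborel :: real measure))
        = (\<Pi>\<^sub>E i\<in>I. (\<lambda>t. t + a i) -` A i)"
      by (auto simp: space_PiM PiE_iff)
    also have "emeasure (\<Pi>\<^sub>M i\<in>I. lborel) (\<Pi>\<^sub>E i\<in>I. (\<lambda>t. t + a i) -` A i)
        = (\<Prod>i\<in>I. emeasure lborel ((\<lambda>t. t + a i) -` A i))"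
    proof (rule emeasure_PiM)
      fix i assume "i \<in> I"
      then show "(\<lambda>t. t + a i) -` A i \<in> sets lborel"
        using measurable_sets[of "\<lambda>t. t + a i" borel borel "A i"] A' by simp
    qed simp
    also have "\<dots> = (\<Prod>i\<in>I. emeasure lborel (A i))"
      using shift by (intro prod.cong) auto
    finally show "emeasure (distr (\<Pi>\<^sub>M i\<in>I. lborel) (\<Pi>\<^sub>M i\<in>I. lborel) (\<lambda>x. \<lambda>i\<in>I. x i + a i)) (Pi\<^sub>E I A)
        = (\<Prod>i\<in>I. emeasure lborel (A i))" .
  qed simp_all
qed

lemma nn_integral_PiM_lborel_shift:
  fixes a :: "'i \<Rightarrow> real"
  assumes "finite I" and f: "f \<in> borel_measurable (\<Pi>\<^sub>M i\<in>I. lborel)"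
  shows "(\<integral>\<^sup>+x. f (\<lambda>i\<in>I. x i + a i) \<partial>(\<Pi>\<^sub>M i\<in>I. lborel)) = (\<integral>\<^sup>+x. f x \<partial>(\<Pi>\<^sub>M i\<in>I. lborel))"
proof -
  have m: "(\<lambda>x. \<lambda>i\<in>I. x i + a i)
      \<in> (\<Pi>\<^sub>M i\<in>I. (lborel :: real measure)) \<rightarrow>\<^sub>M (\<Pi>\<^sub>M i\<in>I. lborel)"
    by measurable
  show ?thesis
    by (subst (2) distr_PiM_lborel_shift[OF assms(1), of a, symmetric])
       (use m f in \<open>simp add: nn_integral_distr\<close>)
qed

text \<open>
  A linear image of Lebesgue measure is translation invariant, hence a multiple of Lebesgue
  measure by Fubini; integrating the rotation invariant function \<open>g\<close> shows that the factor is 1.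
\<close>
lemma distr_PiM_lborel_isometric_involution:
  fixes T :: "('i \<Rightarrow> real) \<Rightarrow> 'i \<Rightarrow> real" and I :: "'i set"
  defines "M \<equiv> \<Pi>\<^sub>M i\<in>I. (lborel :: real measure)"
  assumes fin: "finite I"
    and T: "T \<in> M \<rightarrow>\<^sub>M M"
    and add: "\<And>x y. T (\<lambda>i\<in>I. x i + y i) = (\<lambda>i\<in>I. T x i + T y i)"
    and inv: "\<And>x. x \<in> space M \<Longrightarrow> T (T x) = x"
    and iso: "\<And>x. (\<Sum>i\<in>I. (T x i)\<^sup>2) = (\<Sum>i\<in>I. (x i)\<^sup>2)"
  shows "distr M M T = M"
proof -
  interpret product_sigma_finite "\<lambda>i::'i. lborel :: real measure" ..
  interpret sigma_finite_measure "M"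
    unfolding M_def using fin by (rule sigma_finite)
  interpret pair_sigma_finite "M" "M" ..
  note T [measurable]
  \<comment> \<open>Besides depending on the norm alone, \<open>g\<close> needs a total mass
    \<open>C\<close> strictly between 0 and infinity, so that \<open>C\<close> can be cancelled at
    the end.\<close>
  define g where "g x = ennreal (exp (- (\<Sum>i\<in>I. (x i)\<^sup>2)))" for x :: "'i \<Rightarrow> real"
  have coord [measurable]: "(\<lambda>x. x i) \<in> borel_measurable M" if "i \<in> I" for i
    unfolding M_def using that by measurable
  have shift_meas [measurable]: "(\<lambda>(x, y). \<lambda>i\<in>I. a * x i + b * y i) \<in> M \<Otimes>\<^sub>M M \<rightarrow>\<^sub>M M" for a b
    unfolding M_def by measurable
  have g_meas [measurable]: "g \<in> borel_measurable M"
    unfolding g_def by measurable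
  have g_prod: "g x = (\<Prod>i\<in>I. ennreal (exp (- (x i)\<^sup>2)))" for x
    using fin by (simp add: g_def prod_ennreal sum_negf exp_sum flip: sum_negf)
  have gauss: "(\<integral>\<^sup>+t. ennreal (exp (- t\<^sup>2)) \<partial>lborel) = ennreal (sqrt pi)"
    using nn_integral_exp_minus_square[of 1] by simp
  have g_int: "(\<integral>\<^sup>+x. g x \<partial>M) = ennreal (sqrt pi) ^ card I"
    unfolding g_prod M_def using fin by (subst product_nn_integral_prod) (auto simp: gauss)
  define C where "C = (\<integral>\<^sup>+x. g x \<partial>M)"
  have C: "C \<noteq> 0" "C \<noteq> \<infinity>"
    unfolding C_def g_int by (auto simp: ennreal_power)
  have eq: "(\<integral>\<^sup>+x. f (T x) \<partial>M) = (\<integral>\<^sup>+x. f x \<partial>M)" if f [measurable]: "f \<in> borel_measurable M" for f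
  proof -
    note shift = nn_integral_PiM_lborel_shift[OF fin, folded M_def]
    have "(\<integral>\<^sup>+x. f (T x) \<partial>M) * C = (\<integral>\<^sup>+y. (\<integral>\<^sup>+x. f (T x) * g y \<partial>M) \<partial>M)"
      by (simp add: C_def nn_integral_cmult nn_integral_multc)
    also have "\<dots> = (\<integral>\<^sup>+y. (\<integral>\<^sup>+x. f (\<lambda>i\<in>I. T x i + y i) * g y \<partial>M) \<partial>M)"
    proof (rule nn_integral_cong)
      fix y assume y: "y \<in> space M"
      \<comment> \<open>Substituting x + T y for x adds T (T y) = y to the argument of
        \<open>f\<close>; additivity and the involution property enter here.\<close>
      have "T (\<lambda>i\<in>I. x i + T y i) = (\<lambda>i\<in>I. T x i + y i)" for x
        by (simp add: add inv[OF y])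
      then show "(\<integral>\<^sup>+x. f (T x) * g y \<partial>M) = (\<integral>\<^sup>+x. f (\<lambda>i\<in>I. T x i + y i) * g y \<partial>M)"
        using shift[of "\<lambda>x. f (T x) * g y" "T y"] by simp
    qed
    also have "\<dots> = (\<integral>\<^sup>+x. (\<integral>\<^sup>+y. f (\<lambda>i\<in>I. T x i + y i) * g y \<partial>M) \<partial>M)"
    proof (rule Fubini')
      have "(\<lambda>z. (\<lambda>i\<in>I. T (fst z) i + snd z i)) \<in> M \<Otimes>\<^sub>M M \<rightarrow>\<^sub>M M"
        using measurable_comp[OF _ shift_meas[of 1 1], of "\<lambda>z. (T (fst z), snd z)" "M \<Otimes>\<^sub>M M"]
        by (simp add: comp_def split_beta')
      then show "(\<lambda>(x, y). f (\<lambda>i\<in>I. T x i + y i) * g y) \<in> borel_measurable (M \<Otimes>\<^sub>M M)"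
        by (simp add: split_beta')
    qed
    \<comment> \<open>With y now the inner variable, a shift by - T x frees the argument of
      \<open>f\<close> and moves the translation into \<open>g\<close>.\<close>
    also have "\<dots> = (\<integral>\<^sup>+x. (\<integral>\<^sup>+y. f y * g (\<lambda>i\<in>I. y i - T x i) \<partial>M) \<partial>M)"
    proof (rule nn_integral_cong)
      fix x assume x: "x \<in> space M"
      have 1: "(\<lambda>y. \<lambda>i\<in>I. T x i + y i) \<in> M \<rightarrow>\<^sub>M M"
        unfolding M_def by measurable
      have 2: "(\<lambda>y. f (\<lambda>i\<in>I. T x i + y i) * g y) \<in> borel_measurable M"
        using measurable_compose[OF 1 f] by measurable
      have "f (\<lambda>i\<in>I. T x i + (\<lambda>i\<in>I. y i + - T x i) i) = f y" if "y \<in> space M" for y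
      proof -
        have "(\<lambda>i\<in>I. T x i + (\<lambda>i\<in>I. y i + - T x i) i) = y"
          using that by (auto simp: M_def space_PiM PiE_iff extensional_def)
        then show ?thesis by simp
      qed
      then show "(\<integral>\<^sup>+y. f (\<lambda>i\<in>I. T x i + y i) * g y \<partial>M) = (\<integral>\<^sup>+y. f y * g (\<lambda>i\<in>I. y i - T x i) \<partial>M)"
        using shift[OF 2, of "\<lambda>i. - T x i"] by (simp cong: nn_integral_cong)
    qed
    also have "\<dots> = (\<integral>\<^sup>+y. (\<integral>\<^sup>+x. f y * g (\<lambda>i\<in>I. y i - T x i) \<partial>M) \<partial>M)"
    proof (rule Fubini'[symmetric])
      have "(\<lambda>z. (\<lambda>i\<in>I. snd z i - T (fst z) i)) \<in> M \<Otimes>\<^sub>M M \<rightarrow>\<^sub>M M"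
        using measurable_comp[OF _ shift_meas[of "-1" 1], of "\<lambda>z. (T (fst z), snd z)" "M \<Otimes>\<^sub>M M"]
        by (simp add: comp_def split_beta')
      then show "(\<lambda>(x, y). f y * g (\<lambda>i\<in>I. y i - T x i)) \<in> borel_measurable (M \<Otimes>\<^sub>M M)"
        by (simp add: split_beta')
    qed
    also have "\<dots> = (\<integral>\<^sup>+y. f y * C \<partial>M)"
    proof (rule nn_integral_cong)
      fix y assume y: "y \<in> space M"
      have 1: "(\<lambda>x. \<lambda>i\<in>I. y i - T x i) \<in> M \<rightarrow>\<^sub>M M"
        using measurable_compose[OF T coord]
        unfolding M_def by (intro measurable_restrict) simp
      have 2: "(\<lambda>x. g (\<lambda>i\<in>I. y i - T x i)) \<in> borel_measurable M"
        by (rule measurable_compose[OF 1 g_meas])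
      \<comment> \<open>Under x -> x + T y the vector y - T x becomes - T x, which has the norm of
        x; hence the inner integral is \<open>C\<close>, whatever y is.\<close>
      have "g (\<lambda>i\<in>I. y i - T (\<lambda>i\<in>I. x i + T y i) i) = g x" for x
        by (simp add: add inv[OF y] g_def iso cong: sum.cong)
      then have "(\<integral>\<^sup>+x. g (\<lambda>i\<in>I. y i - T x i) \<partial>M) = C"
        using shift[OF 2, of "T y"] by (simp add: C_def)
      then show "(\<integral>\<^sup>+x. f y * g (\<lambda>i\<in>I. y i - T x i) \<partial>M) = f y * C"
        using 2 by (simp add: nn_integral_cmult)
    qed
    also have "\<dots> = (\<integral>\<^sup>+y. f y \<partial>M) * C"
      by (simp add: nn_integral_multc)
    finally show ?thesis
      using C by (auto simp: mult.commute[of _ C] ennreal_mult_cancel_left)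
  qed
  show ?thesis
  proof (rule measure_eqI)
    fix A assume "A \<in> sets (distr M M T)"
    then have A [measurable]: "A \<in> sets M" by simp
    have "emeasure (distr M M T) A = (\<integral>\<^sup>+x. indicator A (T x) \<partial>M)"
      by (subst nn_integral_distr[symmetric, OF T]) simp_all
    also have "\<dots> = emeasure M A"
      by (subst eq) simp_all
    finally show "emeasure (distr M M T) A = emeasure M A" .
  qed simp
qed

text \<open>The indicator of a box factors over the coordinates, so Fubini splits the integral over
  a box into one-dimensional ones. Assumption \<open>pr\<close> covers every index because
  \<open>product_sigma_finite\<close> quantifies over the whole index type.\<close>

lemma density_PiM_lborel:
  assumes fin: "finite I" and f [measurable]: "\<And>i. i \<in> I \<Longrightarrow> f i \<in> borel_measurable borel"
    and pr: "\<And>i. prob_space (density lborel (f i))"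
  shows "density (\<Pi>\<^sub>M i\<in>I. lborel) (\<lambda>y. \<Prod>i\<in>I. f i (y i :: real)) = (\<Pi>\<^sub>M i\<in>I. density lborel (f i))"
proof -
  interpret product_sigma_finite "\<lambda>i. density lborel (f i)"
    by (intro product_sigma_finite.intro prob_space_imp_sigma_finite pr)
  interpret lb: product_sigma_finite "\<lambda>i. lborel :: real measure" ..
  show ?thesis
  proof (rule PiM_eqI)
    show "sets (density (\<Pi>\<^sub>M i\<in>I. lborel) (\<lambda>y. \<Prod>i\<in>I. f i (y i))) = sets (\<Pi>\<^sub>M i\<in>I. density lborel (f i))"
      by (simp cong: sets_PiM_cong)
    fix A assume A: "\<And>i. i \<in> I \<Longrightarrow> A i \<in> sets (density lborel (f i))"
    then have A' [measurable]: "\<And>i. i \<in> I \<Longrightarrow> A i \<in> sets borel" by simp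
    have m: "(\<lambda>y. \<Prod>i\<in>I. f i (y i)) \<in> borel_measurable (\<Pi>\<^sub>M i\<in>I. lborel)"
      by measurable
    have "emeasure (density (\<Pi>\<^sub>M i\<in>I. lborel) (\<lambda>y. \<Prod>i\<in>I. f i (y i))) (Pi\<^sub>E I A)
        = (\<integral>\<^sup>+y. (\<Prod>i\<in>I. f i (y i)) * indicator (Pi\<^sub>E I A) y \<partial>(\<Pi>\<^sub>M i\<in>I. lborel))"
      using fin A' by (intro emeasure_density m sets_PiM_I_finite) auto
    also have "\<dots> = (\<integral>\<^sup>+y. (\<Prod>i\<in>I. f i (y i) * indicator (A i) (y i)) \<partial>(\<Pi>\<^sub>M i\<in>I. lborel))"
    proof (rule nn_integral_cong)
      fix y assume "y \<in> space (\<Pi>\<^sub>M i\<in>I. (lborel :: real measure))"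
      then have "indicator (Pi\<^sub>E I A) y = (\<Prod>i\<in>I. indicator (A i) (y i) :: ennreal)"
        using fin by (auto simp: space_PiM PiE_iff indicator_def)
      then show "(\<Prod>i\<in>I. f i (y i)) * indicator (Pi\<^sub>E I A) y = (\<Prod>i\<in>I. f i (y i) * indicator (A i) (y i))"
        by (simp add: prod.distrib)
    qed
    also have "\<dots> = (\<Prod>i\<in>I. \<integral>\<^sup>+t. f i t * indicator (A i) t \<partial>lborel)"
      using fin by (intro lb.product_nn_integral_prod) auto
    also have "\<dots> = (\<Prod>i\<in>I. emeasure (density lborel (f i)) (A i))"
      by (intro prod.cong refl) (simp add: emeasure_density)
    finally show "emeasure (density (\<Pi>\<^sub>M i\<in>I. lborel) (\<lambda>y. \<Prod>i\<in>I. f i (y i))) (Pi\<^sub>E I A)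
        = (\<Prod>i\<in>I. emeasure (density lborel (f i)) (A i))" .
  qed (use fin in simp)
qed

section \<open>Discrete Fourier and Hartley transforms\<close>

lemma sum_powers_root_of_unity:
  fixes z :: complex
  assumes "z ^ (L + 1) = 1"
  shows "(\<Sum>l\<le>L. z ^ l) = (if z = 1 then of_nat (L + 1) else 0)"
  using assms sum_gp_strict[of z "Suc L"] by (auto simp: lessThan_Suc_atMost)

text \<open>All plane waves are powers of this one primitive root of unity, so phases become
  natural-number exponents; inverse phases are written as powers of the conjugate.\<close>

definition unit_root :: "nat \<Rightarrow> complex" where
  "unit_root L = exp (\<i> * complex_of_real (2 * pi / real (L + 1)))"

lemma exp_wavenumber: "exp (\<i> * complex_of_real (wavenumber L n * real l)) = unit_root L ^ (n * l)"
  unfolding unit_root_def wavenumber_def exp_of_nat_mult[symmetric]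
  by (simp add: field_simps)

lemma exp_minus_wavenumber:
  "exp (- (\<i> * complex_of_real (wavenumber L n * real l))) = cnj (unit_root L) ^ (n * l)"
  using exp_wavenumber[of L n l, THEN arg_cong, of cnj] by (simp add: exp_cnj)

lemma cmod_unit_root [simp]: "cmod (unit_root L) = 1"
  by (simp add: unit_root_def)

lemma unit_root_mult_cnj [simp]: "unit_root L * cnj (unit_root L) = 1"
  "cnj (unit_root L) * unit_root L = 1"
  using complex_norm_square[of "unit_root L"] by (simp_all add: mult.commute)

lemma unit_root_power_period: "unit_root L ^ Suc L = 1"
proof -
  have "unit_root L ^ Suc L = exp (of_nat (Suc L) * (\<i> * complex_of_real (2 * pi / real (L + 1))))"
    unfolding unit_root_def by (rule exp_of_nat_mult[symmetric])
  also have "of_nat (Suc L) * (\<i> * complex_of_real (2 * pi / real (L + 1))) = 2 * of_real pi * \<i>"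
    by (simp add: field_simps del: of_nat_Suc)
  finally show ?thesis by simp
qed

lemma unit_root_power_eq_1_iff: "unit_root L ^ k = 1 \<longleftrightarrow> Suc L dvd k"
proof
  assume "unit_root L ^ k = 1"
  then have "exp (of_nat k * (\<i> * complex_of_real (2 * pi / real (L + 1)))) = 1"
    unfolding unit_root_def by (simp only: exp_of_nat_mult)
  then obtain m :: int where "real k * (2 * pi / real (L + 1)) = of_int (2 * m) * pi"
    unfolding exp_eq_1 by auto
  then have "pi * real k = pi * (of_int m * real (Suc L))"
    by (simp add: field_simps)
  then have "real k = of_int m * real (Suc L)"
    by simp
  then have "int k = m * int (Suc L)"
    by (metis of_int_eq_iff of_int_mult of_int_of_nat_eq)
  then show "Suc L dvd k"
    by (metis dvd_triv_right int_dvd_int_iff)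
next
  assume "Suc L dvd k"
  then show "unit_root L ^ k = 1"
    by (metis dvd_def power_mult power_one unit_root_power_period)
qed

text \<open>For n \<le> m, cancelling the n-th power makes L + 1 a divisor of m - n \<le> L, which
  forces m - n = 0. The auxiliary fact is used in both orders because exponents are natural
  numbers.\<close>

lemma unit_root_power_inj:
  assumes "n \<le> L" "m \<le> L" "unit_root L ^ n * cnj (unit_root L) ^ m = 1"
  shows "n = m"
proof -
  have *: "n = m" if "n \<le> L" "m \<le> L" "n \<le> m" "unit_root L ^ n = unit_root L ^ m" for n m
  proof -
    have "unit_root L \<noteq> 0" using cmod_unit_root[of L] by force
    then have "unit_root L ^ (m - n) = 1"
      using that by (simp add: power_diff)
    then have "Suc L dvd m - n" by (simp add: unit_root_power_eq_1_iff)
    then show ?thesis using that by (auto dest: dvd_imp_le)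
  qed
  have "unit_root L ^ m = unit_root L ^ n * (cnj (unit_root L) ^ m * unit_root L ^ m)"
    by (metis assms(3) mult.assoc mult_1)
  also have "cnj (unit_root L) ^ m * unit_root L ^ m = 1"
    by (simp flip: power_mult_distrib)
  finally have "unit_root L ^ m = unit_root L ^ n"
    by simp
  then show ?thesis
    using *[of n m] *[of m n] assms(1,2) by (metis nle_le)
qed

text \<open>Orthogonality of characters: the summand is a geometric sequence whose ratio is itself
  an (L + 1)-th root of unity, equal to 1 only for n = m.\<close>

lemma sum_unit_root_orthogonal:
  assumes "n \<le> L" "m \<le> L"
  shows "(\<Sum>l\<le>L. unit_root L ^ (n * l) * cnj (unit_root L) ^ (m * l))
    = (if n = m then of_nat (L + 1) else 0)"
proof -
  let ?z = "unit_root L ^ n * cnj (unit_root L) ^ m"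
  have "cnj (unit_root L) ^ Suc L = cnj (unit_root L ^ Suc L)"
    by (simp only: complex_cnj_power)
  then have c: "cnj (unit_root L) ^ Suc L = 1"
    by (simp only: unit_root_power_period complex_cnj_one)
  have swap: "(a ^ i) ^ k = (a ^ k) ^ i" for a :: complex and i k :: nat
    by (simp only: mult.commute flip: power_mult)
  have p: "?z ^ (L + 1) = 1"
    unfolding power_mult_distrib swap[of _ _ "L + 1"]
    by (simp only: Suc_eq_plus1[symmetric] unit_root_power_period c power_one mult_1)
  have "(\<Sum>l\<le>L. unit_root L ^ (n * l) * cnj (unit_root L) ^ (m * l)) = (\<Sum>l\<le>L. ?z ^ l)"
    by (simp add: power_mult_distrib power_mult)
  moreover have "?z = 1 \<longleftrightarrow> n = m"
    using unit_root_power_inj[OF assms] by (auto simp flip: power_mult_distrib)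
  ultimately show ?thesis
    using sum_powers_root_of_unity[OF p] by simp
qed

section \<open>Fourier inversion, Parseval's identity and the energy in Fourier modes\<close>

lemma fourier_mode_eq:
  "fourier_mode L n \<epsilon> = (\<Sum>l\<le>L. complex_of_real (\<epsilon> l) * unit_root L ^ (n * l)) / of_nat (L + 1)"
  unfolding fourier_mode_def by (simp only: exp_wavenumber)

lemma fourier_expansion_eq:
  "fourier_expansion L \<epsilon> c \<longleftrightarrow>
    (\<forall>l\<le>L. complex_of_real (\<epsilon> l) = (\<Sum>n\<le>L. c n * cnj (unit_root L) ^ (n * l)))"
  unfolding fourier_expansion_def by (simp only: exp_minus_wavenumber)

text \<open>The exponent n l is symmetric in wavenumber and site, so a single orthogonality relation
  serves twice: summed over sites it gives uniqueness, summed over wavenumbers it gives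
  existence.\<close>

lemma fourier_expansion_iff:
  "fourier_expansion L \<epsilon> c \<longleftrightarrow> (\<forall>n\<le>L. c n = fourier_mode L n \<epsilon>)"
proof
  assume exp: "fourier_expansion L \<epsilon> c"
  show "\<forall>n\<le>L. c n = fourier_mode L n \<epsilon>"
  proof (intro allI impI)
    fix m assume m: "m \<le> L"
    have "(\<Sum>l\<le>L. complex_of_real (\<epsilon> l) * unit_root L ^ (m * l))
        = (\<Sum>l\<le>L. \<Sum>n\<le>L. c n * (unit_root L ^ (m * l) * cnj (unit_root L) ^ (n * l)))"
      using exp by (auto simp: fourier_expansion_eq sum_distrib_left sum_distrib_right mult_ac intro!: sum.cong)
    also have "\<dots> = (\<Sum>n\<le>L. c n * (\<Sum>l\<le>L. unit_root L ^ (m * l) * cnj (unit_root L) ^ (n * l)))"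
      by (subst sum.swap) (simp add: sum_distrib_left)
    also have "\<dots> = (\<Sum>n\<le>L. c n * (if m = n then of_nat (L + 1) else 0))"
      using m by (intro sum.cong refl arg_cong2[where f="(*)"] sum_unit_root_orthogonal) auto
    also have "\<dots> = c m * of_nat (L + 1)"
      using m by (simp add: if_distrib[of "(*) _"] cong: if_cong)
    finally show "c m = fourier_mode L m \<epsilon>"
      by (simp add: fourier_mode_eq del: of_nat_Suc)
  qed
next
  assume c: "\<forall>n\<le>L. c n = fourier_mode L n \<epsilon>"
  show "fourier_expansion L \<epsilon> c"
    unfolding fourier_expansion_eq
  proof (intro allI impI)
    fix l assume l: "l \<le> L"
    have "(\<Sum>n\<le>L. c n * cnj (unit_root L) ^ (n * l))
       = (\<Sum>n\<le>L. (\<Sum>k\<le>L. complex_of_real (\<epsilon> k) * (unit_root L ^ (k * n) * cnj (unit_root L) ^ (l * n))) / of_nat (L + 1))"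
      using c by (auto simp: fourier_mode_eq sum_distrib_right sum_distrib_left mult_ac intro!: sum.cong)
    also have "\<dots> = (\<Sum>k\<le>L. complex_of_real (\<epsilon> k) * (\<Sum>n\<le>L. unit_root L ^ (k * n) * cnj (unit_root L) ^ (l * n))) / of_nat (L + 1)"
      unfolding sum_divide_distrib[symmetric] by (subst sum.swap) (simp add: sum_distrib_left)
    also have "\<dots> = (\<Sum>k\<le>L. complex_of_real (\<epsilon> k) * (if k = l then of_nat (L + 1) else 0)) / of_nat (L + 1)"
      using l by (intro arg_cong2[where f="(/)"] sum.cong refl arg_cong2[where f="(*)"] sum_unit_root_orthogonal) auto
    also have "\<dots> = complex_of_real (\<epsilon> l)"
      using l by (simp add: if_distrib[of "(*) _"] cong: if_cong del: of_nat_Suc)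
    finally show "complex_of_real (\<epsilon> l) = (\<Sum>n\<le>L. c n * cnj (unit_root L) ^ (n * l))"
      by simp
  qed
qed

text \<open>The polarised form with two sequences is needed for the nearest-neighbour term, where a
  configuration is paired with its translate.\<close>

lemma parseval:
  assumes f: "\<And>l. l \<le> L \<Longrightarrow> f l = (\<Sum>n\<le>L. c n * cnj (unit_root L) ^ (n * l))"
    and g: "\<And>l. l \<le> L \<Longrightarrow> g l = (\<Sum>n\<le>L. d n * cnj (unit_root L) ^ (n * l))"
  shows "(\<Sum>l\<le>L. f l * cnj (g l)) = of_nat (L + 1) * (\<Sum>n\<le>L. c n * cnj (d n))"
proof -
  have "(\<Sum>l\<le>L. f l * cnj (g l))
      = (\<Sum>l\<le>L. \<Sum>m\<le>L. \<Sum>n\<le>L. c n * cnj (d m) * (unit_root L ^ (m * l) * cnj (unit_root L) ^ (n * l)))"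
  proof (intro sum.cong refl)
    fix l assume "l \<in> {..L}"
    then have "f l * cnj (g l) = (\<Sum>n\<le>L. \<Sum>m\<le>L. c n * cnj (d m) * (unit_root L ^ (m * l) * cnj (unit_root L) ^ (n * l)))"
      by (simp add: f g sum_product mult_ac)
    then show "f l * cnj (g l) = (\<Sum>m\<le>L. \<Sum>n\<le>L. c n * cnj (d m) * (unit_root L ^ (m * l) * cnj (unit_root L) ^ (n * l)))"
      by (subst sum.swap)
  qed
  also have "\<dots> = (\<Sum>m\<le>L. \<Sum>n\<le>L. c n * cnj (d m) * (\<Sum>l\<le>L. unit_root L ^ (m * l) * cnj (unit_root L) ^ (n * l)))"
    unfolding sum_distrib_left by (rule trans[OF sum.swap]) (rule sum.cong[OF refl], rule sum.swap)
  also have "\<dots> = (\<Sum>m\<le>L. \<Sum>n\<le>L. c n * cnj (d m) * (if m = n then of_nat (L + 1) else 0))"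
    by (intro sum.cong refl arg_cong2[where f="(*)"] sum_unit_root_orthogonal) auto
  also have "\<dots> = of_nat (L + 1) * (\<Sum>n\<le>L. c n * cnj (d n))"
    by (simp add: if_distrib[of "(*) _"] sum_distrib_left mult_ac cong: if_cong)
  finally show ?thesis .
qed

lemma energy_fourier:
  assumes exp: "fourier_expansion L \<epsilon> c"
  shows "energy L \<sigma>b \<sigma>w \<epsilon> = real (L + 1) * Delta_w \<sigma>w / \<sigma>b\<^sup>2 *
    (\<Sum>n\<le>L. ((1 + \<sigma>w ^ 4) - 2 * \<sigma>w\<^sup>2 * cos (wavenumber L n)) * (cmod (c n))\<^sup>2)"
proof -
  \<comment> \<open>Translation by one site multiplies each mode by a phase; \<open>d\<close> holds
    the modes of the translate.\<close>
  define d where "d n = c n * unit_root L ^ n" for n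
  have f: "complex_of_real (\<epsilon> l) = (\<Sum>n\<le>L. c n * cnj (unit_root L) ^ (n * l))" if "l \<le> L" for l
    using exp that by (simp add: fourier_expansion_eq)
  have g: "complex_of_real (\<epsilon> (prev_site L l)) = (\<Sum>n\<le>L. d n * cnj (unit_root L) ^ (n * l))"
    if "l \<le> L" for l
  proof -
    have "cnj (unit_root L) ^ (n * prev_site L l) = unit_root L ^ n * cnj (unit_root L) ^ (n * l)" for n
    proof (cases l)
      \<comment> \<open>The wrap-around at site 0, whose predecessor is L: the phase at -L equals
        the phase at 1 because the (L + 1)-th power is 1.\<close>
      case 0
      have "cnj (unit_root L) ^ (n * L) * (cnj (unit_root L) ^ n * unit_root L ^ n)
          = cnj ((unit_root L ^ Suc L) ^ n) * unit_root L ^ n"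
        by (simp add: power_add power_mult_distrib mult_ac flip: power_mult)
      moreover have "cnj (unit_root L) ^ n * unit_root L ^ n = 1"
        by (simp flip: power_mult_distrib)
      ultimately show ?thesis
        using 0 by (simp only: unit_root_power_period) (simp add: prev_site_def)
    next
      case (Suc k)
      have "unit_root L ^ n * cnj (unit_root L) ^ n = 1"
        by (simp flip: power_mult_distrib)
      then show ?thesis
        using Suc by (simp add: prev_site_def power_add mult.assoc[symmetric])
    qed
    moreover have "prev_site L l \<le> L"
      using that by (auto simp: prev_site_def)
    ultimately show ?thesis
      by (simp only: f d_def mult.assoc)
  qed
  have "complex_of_real (\<Sum>l\<le>L. (\<epsilon> l)\<^sup>2) = (\<Sum>l\<le>L. complex_of_real (\<epsilon> l) * cnj (complex_of_real (\<epsilon> l)))"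
    by (simp add: power2_eq_square)
  also have "\<dots> = of_nat (L + 1) * (\<Sum>n\<le>L. c n * cnj (c n))"
    using f by (intro parseval) auto
  also have "\<dots> = complex_of_real (real (L + 1) * (\<Sum>n\<le>L. (cmod (c n))\<^sup>2))"
    unfolding of_real_mult of_real_sum complex_norm_square by simp
  finally have sq: "(\<Sum>l\<le>L. (\<epsilon> l)\<^sup>2) = real (L + 1) * (\<Sum>n\<le>L. (cmod (c n))\<^sup>2)"
    by (simp only: of_real_eq_iff)
  have "complex_of_real (\<Sum>l\<le>L. \<epsilon> l * \<epsilon> (prev_site L l))
      = (\<Sum>l\<le>L. complex_of_real (\<epsilon> l) * cnj (complex_of_real (\<epsilon> (prev_site L l))))"
    by simp
  also have "\<dots> = of_nat (L + 1) * (\<Sum>n\<le>L. c n * cnj (d n))"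
    using f g by (intro parseval) auto
  also have "\<dots> = of_nat (L + 1) * (\<Sum>n\<le>L. complex_of_real ((cmod (c n))\<^sup>2) * cnj (unit_root L ^ n))"
    unfolding complex_norm_square by (simp add: d_def mult_ac)
  \<comment> \<open>The left side is real, so comparing real parts leaves only cosines.\<close>
  finally have "Re (complex_of_real (\<Sum>l\<le>L. \<epsilon> l * \<epsilon> (prev_site L l)))
      = Re (of_nat (L + 1) * (\<Sum>n\<le>L. complex_of_real ((cmod (c n))\<^sup>2) * cnj (unit_root L ^ n)))"
    by (rule arg_cong)
  moreover have "Re (unit_root L ^ n) = cos (wavenumber L n)" for n
    using exp_wavenumber[of L n 1, THEN arg_cong, of Re] by (simp add: Re_exp)
  ultimately have nb: "(\<Sum>l\<le>L. \<epsilon> l * \<epsilon> (prev_site L l))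
      = real (L + 1) * (\<Sum>n\<le>L. (cmod (c n))\<^sup>2 * cos (wavenumber L n))"
    by (simp del: of_real_power complex_cnj_power)
  have "(\<Sum>l\<le>L. (1 + \<sigma>w ^ 4) * (\<epsilon> l)\<^sup>2 - 2 * \<sigma>w\<^sup>2 * \<epsilon> l * \<epsilon> (prev_site L l))
      = (1 + \<sigma>w ^ 4) * (\<Sum>l\<le>L. (\<epsilon> l)\<^sup>2) - 2 * \<sigma>w\<^sup>2 * (\<Sum>l\<le>L. \<epsilon> l * \<epsilon> (prev_site L l))"
    by (simp add: sum_subtractf sum_distrib_left mult.assoc)
  also have "\<dots> = real (L + 1) *
      (\<Sum>n\<le>L. ((1 + \<sigma>w ^ 4) - 2 * \<sigma>w\<^sup>2 * cos (wavenumber L n)) * (cmod (c n))\<^sup>2)"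
    unfolding sq nb by (simp add: sum_subtractf sum_distrib_left algebra_simps)
  finally show ?thesis
    by (simp add: energy_def)
qed

section \<open>Reflection of wavenumbers and the Hartley transform\<close>

lemma neg_index_le [simp]: "neg_index L n \<le> L"
  unfolding neg_index_def by (metis Suc_eq_plus1 less_Suc_eq_le mod_less_divisor zero_less_Suc)

lemma neg_index_eq: "n \<le> L \<Longrightarrow> neg_index L n = (if n = 0 then 0 else L + 1 - n)"
  by (auto simp: neg_index_def)

lemma neg_index_neg_index [simp]: "n \<le> L \<Longrightarrow> neg_index L (neg_index L n) = n"
  by (auto simp: neg_index_eq)

text \<open>The reflected index produces the inverse power, and on the unit circle the inverse is
  the conjugate.\<close>

lemma unit_root_neg_index:
  assumes "n \<le> L"
  shows "unit_root L ^ (neg_index L n * l) = cnj (unit_root L) ^ (n * l)"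
proof -
  have "unit_root L ^ neg_index L n * unit_root L ^ n = 1"
    using assms unit_root_power_period[of L] by (auto simp: neg_index_eq simp flip: power_add)
  then have "unit_root L ^ neg_index L n * (unit_root L ^ n * cnj (unit_root L) ^ n) = cnj (unit_root L) ^ n"
    by (simp add: mult.assoc[symmetric])
  then have "unit_root L ^ neg_index L n = cnj (unit_root L) ^ n"
    by (simp flip: power_mult_distrib)
  then show ?thesis by (simp add: power_mult)
qed

lemma fourier_mode_neg_index:
  "n \<le> L \<Longrightarrow> fourier_mode L (neg_index L n) \<epsilon> = cnj (fourier_mode L n \<epsilon>)"
  by (simp add: fourier_mode_eq unit_root_neg_index)

lemma cos_wavenumber_neg_index: "n \<le> L \<Longrightarrow> cos (wavenumber L (neg_index L n)) = cos (wavenumber L n)"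
  using unit_root_neg_index[of n L 1, folded exp_wavenumber exp_minus_wavenumber, THEN arg_cong, of Re]
  by (simp add: Re_exp)

text \<open>The kernel is real and symmetric in n and l, and the square-root normalisation makes the
  map its own inverse. The restriction puts the image into the extensional space of
  \<open>config_lborel L\<close>.\<close>

definition hartley :: "nat \<Rightarrow> (nat \<Rightarrow> real) \<Rightarrow> nat \<Rightarrow> real" where
  "hartley L x = (\<lambda>n\<in>{..L}. (\<Sum>l\<le>L. (cos (wavenumber L n * real l) + sin (wavenumber L n * real l)) * x l)
     / sqrt (real (L + 1)))"

text \<open>The kernel cos + sin is real part plus imaginary part of the plane wave; the square root
  is the ratio of the two normalisations.\<close>

lemma hartley_eq_fourier_mode:
  assumes "n \<le> L"
  shows "hartley L x n = sqrt (real (L + 1)) * (Re (fourier_mode L n x) + Im (fourier_mode L n x))"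
proof -
  define S where "S = (\<Sum>l\<le>L. complex_of_real (x l) * exp (\<i> * complex_of_real (wavenumber L n * real l)))"
  have "Re S + Im S = (\<Sum>l\<le>L. (cos (wavenumber L n * real l) + sin (wavenumber L n * real l)) * x l)"
    by (simp add: S_def Re_exp Im_exp sum.distrib algebra_simps)
  moreover have "fourier_mode L n x = S / complex_of_real (real (L + 1))"
    unfolding fourier_mode_def S_def by simp
  ultimately have "hartley L x n = (Re S + Im S) / sqrt (real (L + 1))"
    and "Re (fourier_mode L n x) + Im (fourier_mode L n x) = (Re S + Im S) / real (L + 1)"
    using assms by (simp_all add: hartley_def Re_divide_of_real Im_divide_of_real
          del: of_nat_Suc of_nat_add of_real_of_nat_eq flip: add_divide_distrib)
  moreover have "a / sqrt (real (L + 1)) = sqrt (real (L + 1)) * (a / real (L + 1))" for a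
    using real_div_sqrt[of "real (L + 1)"] by (simp add: divide_simps)
  ultimately show ?thesis
    by simp
qed

text \<open>Conjugation symmetry turns Re + Im at n into Re - Im at the reflected index; solving
  these two equations gives the formula. At a self-reflected index the imaginary part
  vanishes.\<close>

lemma fourier_mode_eq_hartley:
  assumes "n \<le> L"
  shows "fourier_mode L n x =
    Complex ((hartley L x n + hartley L x (neg_index L n)) / (2 * sqrt (real (L + 1))))
            ((hartley L x n - hartley L x (neg_index L n)) / (2 * sqrt (real (L + 1))))"
proof -
  define s where "s = sqrt (real (L + 1))"
  have "s \<noteq> 0" by (simp add: s_def)
  have "hartley L x n = s * (Re (fourier_mode L n x) + Im (fourier_mode L n x))"
    "hartley L x (neg_index L n) = s * (Re (fourier_mode L n x) - Im (fourier_mode L n x))"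
    using assms by (simp_all only: s_def hartley_eq_fourier_mode neg_index_le fourier_mode_neg_index) simp
  then show ?thesis
    unfolding s_def[symmetric] using \<open>s \<noteq> 0\<close>
    by (simp add: complex_eq_iff field_simps)
qed

lemma hartley_add: "hartley L (\<lambda>i\<in>{..L}. x i + y i) = (\<lambda>i\<in>{..L}. hartley L x i + hartley L y i)"
  by (auto simp: hartley_def fun_eq_iff sum.distrib add_divide_distrib algebra_simps)

lemma hartley_hartley:
  assumes "x \<in> extensional {..L}"
  shows "hartley L (hartley L x) = x"
proof
  fix m
  show "hartley L (hartley L x) m = x m"
  proof (cases "m \<le> L")
    case True
    \<comment> \<open>In terms of \<open>cas\<close> a product of two kernels splits into Re (a cnj
      b) + Im (a b), and each term is summed by orthogonality of characters.\<close>
    define cas where "cas t = Re ((1 - \<i>) * t)" for t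
    have cas: "cos (wavenumber L n * real l) + sin (wavenumber L n * real l) = cas (unit_root L ^ (n * l))" for n l
      unfolding cas_def exp_wavenumber[symmetric] by (simp add: Re_exp Im_exp)
    have cas_mult: "cas a * cas b = Re (a * cnj b) + Im (a * b)" for a b
      by (simp add: cas_def algebra_simps)
    have orth: "(\<Sum>n\<le>L. cas (unit_root L ^ (m * n)) * cas (unit_root L ^ (n * l))) = (if m = l then real (L + 1) else 0)"
      if l: "l \<le> L" for l
    proof -
      \<comment> \<open>Reflecting l brings the second sum into orthogonality form; its value is
        real, so its imaginary part contributes nothing.\<close>
      have 1: "(\<Sum>n\<le>L. unit_root L ^ (m * n) * unit_root L ^ (n * l)) = (\<Sum>n\<le>L. unit_root L ^ (m * n) * cnj (unit_root L) ^ (neg_index L l * n))"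
        using unit_root_neg_index[of "neg_index L l" L] l
        by (intro sum.cong refl arg_cong2[where f="(*)"]) (simp add: mult.commute)
      have 2: "(\<Sum>n\<le>L. unit_root L ^ (m * n) * cnj (unit_root L) ^ (n * l)) = (\<Sum>n\<le>L. unit_root L ^ (m * n) * cnj (unit_root L) ^ (l * n))"
        by (simp add: mult.commute)
      have "(\<Sum>n\<le>L. cas (unit_root L ^ (m * n)) * cas (unit_root L ^ (n * l)))
          = Re (\<Sum>n\<le>L. unit_root L ^ (m * n) * cnj (unit_root L) ^ (n * l)) + Im (\<Sum>n\<le>L. unit_root L ^ (m * n) * unit_root L ^ (n * l))"
        unfolding cas_mult sum.distrib Re_sum Im_sum by simp
      also have "\<dots> = (if m = l then real (L + 1) else 0)"
        unfolding 1 2 using True l by (simp add: sum_unit_root_orthogonal)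
      finally show ?thesis .
    qed
    have "hartley L (hartley L x) m = (\<Sum>n\<le>L. cas (unit_root L ^ (m * n)) * (\<Sum>l\<le>L. cas (unit_root L ^ (n * l)) * x l)) / (L + 1)"
    proof -
      have *: "a * (b / sqrt (real (L + 1))) = a * b / sqrt (real (L + 1))"
          "a / sqrt (real (L + 1)) / sqrt (real (L + 1)) = a / real (L + 1)" for a b
        by (simp_all add: field_simps)
      have "hartley L (hartley L x) m = (\<Sum>n\<le>L. cas (unit_root L ^ (m * n)) *
          ((\<Sum>l\<le>L. cas (unit_root L ^ (n * l)) * x l) / sqrt (real (L + 1)))) / sqrt (real (L + 1))"
        using True by (simp add: hartley_def cas)
      then show ?thesis
        unfolding * sum_divide_distrib[symmetric] by simp
    qed
    also have "\<dots> = (\<Sum>l\<le>L. (\<Sum>n\<le>L. cas (unit_root L ^ (m * n)) * cas (unit_root L ^ (n * l))) * x l) / (L + 1)"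
      unfolding sum_distrib_left sum_distrib_right by (subst sum.swap) (simp add: mult.assoc)
    also have "\<dots> = (\<Sum>l\<le>L. if m = l then real (L + 1) * x l else 0) / (L + 1)"
      by (intro arg_cong2[where f="(/)"] sum.cong refl) (auto simp: orth)
    also have "\<dots> = x m"
      using True by (simp del: of_nat_Suc)
    finally show ?thesis .
  next
    case False
    then show ?thesis using assms by (simp add: hartley_def extensional_def)
  qed
qed

text \<open>For a single mode, (L + 1) |c|^2 is only the average of the squared Hartley coordinates
  at n and its reflection. An even weight lets the reindexing by reflection merge the two
  halves.\<close>

lemma sum_even_hartley:
  assumes w: "\<And>n. n \<le> L \<Longrightarrow> w (neg_index L n) = w n"
  shows "real (L + 1) * (\<Sum>n\<le>L. w n * (cmod (fourier_mode L n x))\<^sup>2) = (\<Sum>n\<le>L. w n * (hartley L x n)\<^sup>2)"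
proof -
  let ?h = "hartley L x"
  have "real (L + 1) * (cmod (fourier_mode L n x))\<^sup>2 = ((?h n)\<^sup>2 + (?h (neg_index L n))\<^sup>2) / 2" if "n \<le> L" for n
  proof -
    have "(cmod (fourier_mode L n x))\<^sup>2 = ((?h n)\<^sup>2 + (?h (neg_index L n))\<^sup>2) / 2 / (sqrt (real (L + 1)))\<^sup>2"
      unfolding fourier_mode_eq_hartley[OF that] cmod_power2
      by (simp add: power_divide power2_sum power2_diff power_mult_distrib add_divide_distrib diff_divide_distrib del: of_nat_Suc real_sqrt_pow2_iff real_sqrt_pow2 of_nat_add)
    then show ?thesis by (simp del: of_nat_Suc)
  qed
  then have "real (L + 1) * (\<Sum>n\<le>L. w n * (cmod (fourier_mode L n x))\<^sup>2)
      = (\<Sum>n\<le>L. w n * (((?h n)\<^sup>2 + (?h (neg_index L n))\<^sup>2) / 2))"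
    unfolding sum_distrib_left
    by (intro sum.cong refl) (simp only: mult.left_commute[of "real (L + 1)"] atMost_iff)
  also have "\<dots> = ((\<Sum>n\<le>L. w n * (?h n)\<^sup>2) + (\<Sum>n\<le>L. w (neg_index L n) * (?h (neg_index L n))\<^sup>2)) / 2"
    by (simp add: w sum.distrib distrib_left flip: sum_divide_distrib add_divide_distrib)
  also have "(\<Sum>n\<le>L. w (neg_index L n) * (?h (neg_index L n))\<^sup>2) = (\<Sum>n\<le>L. w n * (?h n)\<^sup>2)"
    by (rule sum.reindex_bij_witness[of _ "neg_index L" "neg_index L"]) auto
  finally show ?thesis by simp
qed

lemma energy_hartley:
  "energy L \<sigma>b \<sigma>w x = Delta_w \<sigma>w / \<sigma>b\<^sup>2 *
    (\<Sum>n\<le>L. ((1 + \<sigma>w ^ 4) - 2 * \<sigma>w\<^sup>2 * cos (wavenumber L n)) * (hartley L x n)\<^sup>2)"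
proof -
  have "fourier_expansion L x (\<lambda>n. fourier_mode L n x)"
    by (simp add: fourier_expansion_iff)
  then show ?thesis
    by (simp add: energy_fourier cos_wavenumber_neg_index flip: sum_even_hartley)
qed

lemma sum_hartley_squared: "(\<Sum>n\<le>L. (hartley L x n)\<^sup>2) = (\<Sum>l\<le>L. (x l)\<^sup>2)"
proof -
  have "fourier_expansion L x (\<lambda>n. fourier_mode L n x)"
    by (simp add: fourier_expansion_iff)
  then have f: "complex_of_real (x l) = (\<Sum>n\<le>L. fourier_mode L n x * cnj (unit_root L) ^ (n * l))"
    if "l \<le> L" for l
    using that by (simp add: fourier_expansion_eq)
  have "complex_of_real (\<Sum>l\<le>L. (x l)\<^sup>2) = (\<Sum>l\<le>L. complex_of_real (x l) * cnj (complex_of_real (x l)))"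
    by (simp add: power2_eq_square)
  also have "\<dots> = of_nat (L + 1) * (\<Sum>n\<le>L. fourier_mode L n x * cnj (fourier_mode L n x))"
    using f by (intro parseval) auto
  \<comment> \<open>The factor 1 is the constant even weight to which
    \<open>sum_even_hartley\<close> is applied.\<close>
  also have "\<dots> = complex_of_real (real (L + 1) * (\<Sum>n\<le>L. 1 * (cmod (fourier_mode L n x))\<^sup>2))"
    unfolding of_real_mult of_real_sum mult_1 complex_norm_square by simp
  finally show ?thesis
    by (simp only: of_real_eq_iff sum_even_hartley) simp
qed

section \<open>Law of the Hartley coordinates and of the Fourier modes\<close>

text \<open>Eigenvalue of the energy in the orthonormal Hartley basis; the factor L + 1 of the
  Fourier formula is absorbed by the normalisation of \<open>hartley\<close>.\<close>

definition mode_rate :: "nat \<Rightarrow> real \<Rightarrow> real \<Rightarrow> nat \<Rightarrow> real" where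
  "mode_rate L \<sigma>b \<sigma>w n = Delta_w \<sigma>w / \<sigma>b\<^sup>2 * ((1 + \<sigma>w ^ 4) - 2 * \<sigma>w\<^sup>2 * cos (wavenumber L n))"

text \<open>The worst case is cos q = 1, where the bracket becomes the perfect square of 1 -
  \<sigma>w^2.\<close>

lemma mode_rate_pos:
  assumes "0 < \<sigma>b\<^sup>2" "\<sigma>w\<^sup>2 < 1"
  shows "0 < mode_rate L \<sigma>b \<sigma>w n"
proof -
  have "0 < (1 - \<sigma>w\<^sup>2)\<^sup>2"
    using assms by simp
  also have "\<dots> = 1 + \<sigma>w ^ 4 - 2 * \<sigma>w\<^sup>2 * 1"
    by (simp add: power2_diff flip: power_mult)
  also have "\<dots> \<le> (1 + \<sigma>w ^ 4) - 2 * \<sigma>w\<^sup>2 * cos (wavenumber L n)"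
    by (intro diff_left_mono mult_left_mono) auto
  finally show ?thesis
    using assms by (auto simp: mode_rate_def Delta_w_def intro!: mult_pos_pos divide_pos_pos)
qed

lemma energy_eq_mode_rate: "energy L \<sigma>b \<sigma>w x = (\<Sum>n\<le>L. mode_rate L \<sigma>b \<sigma>w n * (hartley L x n)\<^sup>2)"
  unfolding energy_hartley mode_rate_def by (simp add: sum_distrib_left mult.assoc)

section \<open>Change of variables to Hartley coordinates and the Gaussian normalisation\<close>

lemma hartley_measurable [measurable]: "hartley L \<in> config_lborel L \<rightarrow>\<^sub>M config_lborel L"
  unfolding config_lborel_def hartley_def by measurable

lemma hartley_component_measurable [measurable]: "(\<lambda>x. hartley L x n) \<in> borel_measurable (config_lborel L)"
proof (cases "n \<le> L")
  case True
  then have "n \<in> {..L}" by simp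
  then have "(\<lambda>x. x n) \<in> borel_measurable (config_lborel L)"
    unfolding config_lborel_def by measurable
  from measurable_compose[OF hartley_measurable this] show ?thesis .
qed (simp add: hartley_def)

lemma energy_measurable [measurable]: "energy L \<sigma>b \<sigma>w \<in> borel_measurable (config_lborel L)"
  unfolding energy_eq_mode_rate[abs_def] by measurable

text \<open>This plays the role of a unit Jacobian: densities pass between sites and Hartley
  coordinates without a factor.\<close>

lemma distr_hartley: "distr (config_lborel L) (config_lborel L) (hartley L) = config_lborel L"
  unfolding config_lborel_def
  by (rule distr_PiM_lborel_isometric_involution)
     (auto simp: hartley_measurable[unfolded config_lborel_def] hartley_add sum_hartley_squared
        space_PiM PiE_def intro!: hartley_hartley)

abbreviation mode_density :: "nat \<Rightarrow> real \<Rightarrow> real \<Rightarrow> nat \<Rightarrow> real \<Rightarrow> real" where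
  "mode_density L \<sigma>b \<sigma>w n \<equiv> normal_density 0 (sqrt (1 / (2 * mode_rate L \<sigma>b \<sigma>w n)))"

context
  fixes L :: nat and \<sigma>b \<sigma>w :: real
  assumes \<sigma>b: "0 < \<sigma>b\<^sup>2" and \<sigma>w: "\<sigma>w\<^sup>2 < 1"
begin

text \<open>The first product, free of \<open>x\<close>, will turn out to be the partition function;
  the second is a probability density in Hartley coordinates.\<close>

lemma exp_minus_energy:
  "exp (- energy L \<sigma>b \<sigma>w x) = (\<Prod>n\<le>L. sqrt (pi / mode_rate L \<sigma>b \<sigma>w n)) *
    (\<Prod>n\<le>L. mode_density L \<sigma>b \<sigma>w n (hartley L x n))"
  unfolding energy_eq_mode_rate
  by (simp add: exp_sum mode_rate_pos[OF \<sigma>b \<sigma>w] flip: sum_negf prod.distrib)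
     (simp add: exp_minus_square_eq_normal_density mode_rate_pos[OF \<sigma>b \<sigma>w])

lemma prob_space_mode_density: "prob_space (density lborel (mode_density L \<sigma>b \<sigma>w n))"
  by (rule prob_space_normal_density) (simp add: mode_rate_pos[OF \<sigma>b \<sigma>w])

lemma density_config_mode_density:
  "density (config_lborel L) (\<lambda>y. ennreal (\<Prod>n\<le>L. mode_density L \<sigma>b \<sigma>w n (y n)))
    = (\<Pi>\<^sub>M n\<in>{..L}. density lborel (mode_density L \<sigma>b \<sigma>w n))"
  unfolding config_lborel_def
  by (subst density_PiM_lborel[symmetric])
     (auto simp: prob_space_mode_density prod_ennreal)

lemma coordinate_measurable: "n \<in> {..L} \<Longrightarrow> (\<lambda>x. x n) \<in> borel_measurable (config_lborel L)"
  unfolding config_lborel_def by measurable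

lemma mode_density_prod_measurable [measurable]:
  "(\<lambda>y. ennreal (\<Prod>n\<le>L. mode_density L \<sigma>b \<sigma>w n (y n))) \<in> borel_measurable (config_lborel L)"
  using coordinate_measurable by measurable

text \<open>A density that depends on \<open>x\<close> only through \<open>hartley L x\<close> is
  carried to the image measure, which by \<open>distr_hartley\<close> is Lebesgue measure
  again.\<close>

lemma distr_density_hartley:
  "distr (density (config_lborel L) (\<lambda>x. ennreal (\<Prod>n\<le>L. mode_density L \<sigma>b \<sigma>w n (hartley L x n))))
     (config_lborel L) (hartley L) = (\<Pi>\<^sub>M n\<in>{..L}. density lborel (mode_density L \<sigma>b \<sigma>w n))"
  using density_distr[OF mode_density_prod_measurable hartley_measurable]
  by (simp add: distr_hartley density_config_mode_density)

text \<open>The image of this density is a product of probability measures, and taking images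
  preserves total mass, so no multiple integral is evaluated.\<close>

lemma nn_integral_mode_density_prod:
  "(\<integral>\<^sup>+x. ennreal (\<Prod>n\<le>L. mode_density L \<sigma>b \<sigma>w n (hartley L x n)) \<partial>config_lborel L) = 1"
proof -
  let ?D = "density (config_lborel L) (\<lambda>x. ennreal (\<Prod>n\<le>L. mode_density L \<sigma>b \<sigma>w n (hartley L x n)))"
  have "prob_space (distr ?D (config_lborel L) (hartley L))"
    unfolding distr_density_hartley by (intro prob_space_PiM prob_space_mode_density)
  then have "prob_space ?D"
    by (rule prob_space_distrD[rotated]) simp
  then show ?thesis
    using prob_space.emeasure_space_1 by (force simp: emeasure_density cong: nn_integral_cong)
qed

text \<open>Working with the nonnegative integral first yields integrability together with the
  value; a Bochner integral alone could be 0 by default.\<close>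

lemma has_bochner_integral_exp_minus_energy:
  "has_bochner_integral (config_lborel L) (\<lambda>x. exp (- energy L \<sigma>b \<sigma>w x))
    (\<Prod>n\<le>L. sqrt (pi / mode_rate L \<sigma>b \<sigma>w n))"
proof (rule has_bochner_integral_nn_integral)
  have c: "0 \<le> (\<Prod>n\<le>L. sqrt (pi / mode_rate L \<sigma>b \<sigma>w n))"
    using mode_rate_pos[OF \<sigma>b \<sigma>w] by (intro prod_nonneg) (auto intro: less_imp_le)
  then show "0 \<le> (\<Prod>n\<le>L. sqrt (pi / mode_rate L \<sigma>b \<sigma>w n))" .
  show "(\<integral>\<^sup>+x. ennreal (exp (- energy L \<sigma>b \<sigma>w x)) \<partial>config_lborel L)
      = ennreal (\<Prod>n\<le>L. sqrt (pi / mode_rate L \<sigma>b \<sigma>w n))"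
    unfolding exp_minus_energy using c
    by (simp add: ennreal_mult prod_nonneg nn_integral_cmult nn_integral_mode_density_prod)
qed simp_all

lemma partition_fun_eq: "partition_fun L \<sigma>b \<sigma>w = (\<Prod>n\<le>L. sqrt (pi / mode_rate L \<sigma>b \<sigma>w n))"
  unfolding partition_fun_def
  by (rule has_bochner_integral_integral_eq[OF has_bochner_integral_exp_minus_energy])

lemma partition_fun_pos: "0 < partition_fun L \<sigma>b \<sigma>w"
  unfolding partition_fun_eq using mode_rate_pos[OF \<sigma>b \<sigma>w] by (intro prod_pos) auto

lemma fluct_distr_eq:
  "fluct_distr L \<sigma>b \<sigma>w =
    density (config_lborel L) (\<lambda>x. ennreal (\<Prod>n\<le>L. mode_density L \<sigma>b \<sigma>w n (hartley L x n)))"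
  using partition_fun_pos
  unfolding fluct_distr_def exp_minus_energy partition_fun_eq[symmetric] by simp

lemma prob_space_fluct_distr: "prob_space (fluct_distr L \<sigma>b \<sigma>w)"
  unfolding fluct_distr_eq
  by (rule prob_spaceI) (simp add: emeasure_density nn_integral_mode_density_prod cong: nn_integral_cong)

section \<open>Independence of the Hartley coordinates and its consequences for the Fourier
  modes\<close>

lemma measurable_fluct_distr [simp]: "measurable (fluct_distr L \<sigma>b \<sigma>w) N = measurable (config_lborel L) N"
  by (rule measurable_cong_sets) (simp_all add: fluct_distr_def)

interpretation prob_space "fluct_distr L \<sigma>b \<sigma>w"
  by (rule prob_space_fluct_distr)

lemma distr_hartley_component:
  assumes n: "n \<in> {..L}"
  shows "distr (fluct_distr L \<sigma>b \<sigma>w) borel (\<lambda>x. hartley L x n)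
    = density lborel (mode_density L \<sigma>b \<sigma>w n)"
proof -
  let ?N = "\<lambda>n. density lborel (mode_density L \<sigma>b \<sigma>w n)"
  have "distr (fluct_distr L \<sigma>b \<sigma>w) borel (\<lambda>x. hartley L x n)
      = distr (distr (fluct_distr L \<sigma>b \<sigma>w) (config_lborel L) (hartley L)) borel (\<lambda>y. y n)"
    using coordinate_measurable[OF n] by (subst distr_distr) (auto simp: comp_def)
  also have "distr (fluct_distr L \<sigma>b \<sigma>w) (config_lborel L) (hartley L) = (\<Pi>\<^sub>M n\<in>{..L}. ?N n)"
    unfolding fluct_distr_eq by (rule distr_density_hartley)
  also have "distr (\<Pi>\<^sub>M n\<in>{..L}. ?N n) borel (\<lambda>y. y n) = distr (\<Pi>\<^sub>M n\<in>{..L}. ?N n) (?N n) (\<lambda>y. y n)"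
    by (rule distr_cong) simp_all
  also have "\<dots> = ?N n"
    using n by (intro distr_PiM_component prob_space_mode_density)
  finally show ?thesis .
qed

lemma distributed_hartley:
  assumes "n \<in> {..L}"
  shows "distributed (fluct_distr L \<sigma>b \<sigma>w) lborel (\<lambda>x. hartley L x n) (mode_density L \<sigma>b \<sigma>w n)"
  unfolding distributed_def
  using distr_hartley_component[OF assms] by (auto cong: distr_cong)

lemma indep_vars_hartley: "indep_vars (\<lambda>_. borel) (\<lambda>n x. hartley L x n) {..L}"
proof (subst indep_vars_iff_distr_eq_PiM')
  \<comment> \<open>The transform is already extensional, so the tuple of coordinates is
    \<open>hartley L x\<close> itself and its law is known.\<close>
  have restr: "(\<lambda>n\<in>{..L}. hartley L x n) = hartley L x" for x
    by (auto simp: hartley_def)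
  have "distr (fluct_distr L \<sigma>b \<sigma>w) (\<Pi>\<^sub>M n\<in>{..L}. borel) (\<lambda>x. \<lambda>n\<in>{..L}. hartley L x n)
      = distr (fluct_distr L \<sigma>b \<sigma>w) (config_lborel L) (hartley L)"
    unfolding restr by (rule distr_cong) (auto simp: config_lborel_def cong: sets_PiM_cong)
  also have "\<dots> = (\<Pi>\<^sub>M n\<in>{..L}. distr (fluct_distr L \<sigma>b \<sigma>w) borel (\<lambda>x. hartley L x n))"
    unfolding fluct_distr_eq distr_density_hartley
    by (rule PiM_cong) (simp_all add: distr_hartley_component[unfolded fluct_distr_eq])
  finally show "distr (fluct_distr L \<sigma>b \<sigma>w) (\<Pi>\<^sub>M n\<in>{..L}. borel) (\<lambda>x. \<lambda>n\<in>{..L}. hartley L x n)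
      = (\<Pi>\<^sub>M n\<in>{..L}. distr (fluct_distr L \<sigma>b \<sigma>w) borel (\<lambda>x. hartley L x n))" .
qed auto

lemma gaussian_rv_hartley_combination: "gaussian_rv (fluct_distr L \<sigma>b \<sigma>w) (\<lambda>x. \<Sum>n\<le>L. w n * hartley L x n)"
proof -
  \<comment> \<open>\<open>sum_indep_normal\<close> requires positive standard deviations, so zero
    coefficients are discarded. If none remain, the combination is constant: the degenerate case of
    \<open>gaussian_rv\<close>.\<close>
  define J where "J = {n. n \<le> L \<and> w n \<noteq> 0}"
  have J: "finite J" "J \<subseteq> {..L}"
    by (auto simp: J_def)
  \<comment> \<open>The added 0 gives the summands the shape produced by
    \<open>normal_density_affine\<close>.\<close>
  have sum_J: "(\<Sum>n\<le>L. w n * hartley L x n) = (\<Sum>n\<in>J. 0 + w n * hartley L x n)" for x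
    by (simp, rule sum.mono_neutral_right) (auto simp: J_def)
  show ?thesis
  proof (cases "J = {}")
    case True
    then show ?thesis
      by (auto simp: gaussian_rv_def sum_J)
  next
    case False
    define s where "s n = \<bar>w n\<bar> * sqrt (1 / (2 * mode_rate L \<sigma>b \<sigma>w n))" for n
    have s: "0 < s n" if "n \<in> J" for n
      using that mode_rate_pos[OF \<sigma>b \<sigma>w] by (auto simp: s_def J_def)
    have "distributed (fluct_distr L \<sigma>b \<sigma>w) lborel (\<lambda>x. 0 + w n * hartley L x n) (normal_density (0 + w n * 0) (s n))"
      if "n \<in> J" for n
      unfolding s_def using that J mode_rate_pos[OF \<sigma>b \<sigma>w]
      by (intro normal_density_affine distributed_hartley) (auto simp: J_def)
    moreover have "indep_vars (\<lambda>_. borel) (\<lambda>n x. 0 + w n * hartley L x n) J"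
      by (rule indep_vars_compose2[OF indep_vars_subset[OF indep_vars_hartley J(2)], where Y="\<lambda>n t. 0 + w n * t"]) simp
    ultimately have "distributed (fluct_distr L \<sigma>b \<sigma>w) lborel (\<lambda>x. \<Sum>n\<in>J. 0 + w n * hartley L x n)
        (normal_density (\<Sum>n\<in>J. 0 + w n * 0) (sqrt (\<Sum>n\<in>J. (s n)\<^sup>2)))"
      using J(1) False s by (intro sum_indep_normal) auto
    moreover have "0 < sqrt (\<Sum>n\<in>J. (s n)\<^sup>2)"
      using J(1) False s by (auto intro!: sum_pos zero_less_power)
    ultimately show ?thesis
      unfolding gaussian_rv_def sum_J by auto
  qed
qed

lemma fourier_mode_measurable: "fourier_mode L n \<in> borel_measurable (config_lborel L)"
proof -
  have [measurable]: "(\<lambda>x. x l) \<in> borel_measurable (config_lborel L)" if "l \<in> {..L}" for l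
    using that by (rule coordinate_measurable)
  show ?thesis
    unfolding fourier_mode_def by measurable
qed

lemma jointly_gaussian_fourier_mode: "jointly_gaussian (fluct_distr L \<sigma>b \<sigma>w) {..L} (fourier_mode L)"
  unfolding jointly_gaussian_def
proof (intro conjI ballI allI)
  show "fourier_mode L n \<in> borel_measurable (fluct_distr L \<sigma>b \<sigma>w)" for n
    by (simp add: fourier_mode_measurable)
  fix a b :: "nat \<Rightarrow> real"
  define s where "s = 2 * sqrt (real (L + 1))"
  \<comment> \<open>Weights with which the n-th summand enters the coordinates at n and at its
    reflection; reindexing the second family by reflection collects one coefficient per
    coordinate.\<close>
  define u v where "u n = (a n + b n) / s" and "v n = (a n - b n) / s" for n
  have "(\<Sum>n\<le>L. a n * Re (fourier_mode L n x) + b n * Im (fourier_mode L n x))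
      = (\<Sum>n\<le>L. (u n + v (neg_index L n)) * hartley L x n)" for x
  proof -
    have "(\<Sum>n\<le>L. a n * Re (fourier_mode L n x) + b n * Im (fourier_mode L n x))
        = (\<Sum>n\<le>L. u n * hartley L x n + v n * hartley L x (neg_index L n))"
    proof (intro sum.cong refl)
      fix n assume "n \<in> {..L}"
      then have "Re (fourier_mode L n x) = (hartley L x n + hartley L x (neg_index L n)) / s"
        "Im (fourier_mode L n x) = (hartley L x n - hartley L x (neg_index L n)) / s"
        by (simp_all add: fourier_mode_eq_hartley s_def)
      then show "a n * Re (fourier_mode L n x) + b n * Im (fourier_mode L n x)
          = u n * hartley L x n + v n * hartley L x (neg_index L n)"
        by (simp only:) (simp add: u_def v_def add_divide_distrib diff_divide_distrib algebra_simps)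
    qed
    also have "\<dots> = (\<Sum>n\<le>L. u n * hartley L x n) + (\<Sum>n\<le>L. v n * hartley L x (neg_index L n))"
      by (rule sum.distrib)
    also have "(\<Sum>n\<le>L. v n * hartley L x (neg_index L n)) = (\<Sum>n\<le>L. v (neg_index L n) * hartley L x n)"
      by (rule sum.reindex_bij_witness[of _ "neg_index L" "neg_index L"]) auto
    finally show ?thesis
      by (simp add: sum.distrib distrib_right)
  qed
  then show "gaussian_rv (fluct_distr L \<sigma>b \<sigma>w)
      (\<lambda>x. \<Sum>n\<le>L. a n * Re (fourier_mode L n x) + b n * Im (fourier_mode L n x))"
    by (simp only: gaussian_rv_hartley_combination)
qed

lemma indep_vars_fourier_mode:
  assumes S: "S \<subseteq> {..L}" and neg: "\<And>m n. m \<in> S \<Longrightarrow> n \<in> S \<Longrightarrow> m \<noteq> n \<Longrightarrow> m \<noteq> neg_index L n"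
  shows "indep_vars (\<lambda>_. borel) (fourier_mode L) S"
proof -
  \<comment> \<open>The block of coordinates that determines mode n; it is a singleton when n is its
    own reflection.\<close>
  define K where "K n = {n, neg_index L n}" for n
  define F where "F n y = Complex ((y n + y (neg_index L n)) / (2 * sqrt (real (L + 1))))
    ((y n - y (neg_index L n)) / (2 * sqrt (real (L + 1))))" for n and y :: "nat \<Rightarrow> real"
  have sites: "K n \<subseteq> {..L}" if "n \<in> S" for n
    using that S by (auto simp: K_def)
  have disj: "disjoint_family_on K S"
    unfolding disjoint_family_on_def
  proof (intro ballI impI)
    fix m n assume mn: "m \<in> S" "n \<in> S" "m \<noteq> n"
    \<comment> \<open>Reflection is injective, being an involution; the mixed coincidences are
      excluded by \<open>neg\<close> used in both orders.\<close>
    then have "neg_index L m \<noteq> neg_index L n"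
      using S by (metis atMost_iff neg_index_neg_index subsetD)
    then show "K m \<inter> K n = {}"
      using neg[OF mn] neg[OF mn(2,1)] mn(3) by (auto simp: K_def)
  qed
  have "indep_vars (\<lambda>n. PiM (K n) (\<lambda>_. borel)) (\<lambda>n x. restrict (\<lambda>i. hartley L x i) (K n)) S"
    by (rule indep_vars_restrict[OF indep_vars_hartley sites disj])
  then have "indep_vars (\<lambda>_. borel) (\<lambda>n x. F n (restrict (\<lambda>i. hartley L x i) (K n))) S"
  proof (rule indep_vars_compose2)
    fix n
    have [measurable]: "(\<lambda>y. y n) \<in> borel_measurable (PiM (K n) (\<lambda>_. borel :: real measure))"
      "(\<lambda>y. y (neg_index L n)) \<in> borel_measurable (PiM (K n) (\<lambda>_. borel :: real measure))"
      by (auto simp: K_def intro!: measurable_component_singleton)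
    show "F n \<in> borel_measurable (PiM (K n) (\<lambda>_. borel))"
      unfolding F_def Complex_eq by measurable
  qed
  moreover have "(\<lambda>x. F n (restrict (\<lambda>i. hartley L x i) (K n))) = fourier_mode L n" if "n \<in> S" for n
  proof
    fix x
    have "n \<le> L" using that S by auto
    then show "F n (restrict (\<lambda>i. hartley L x i) (K n)) = fourier_mode L n x"
      by (simp add: F_def K_def fourier_mode_eq_hartley)
  qed
  ultimately show ?thesis
    using indep_vars_cong[OF refl _ refl, of S "\<lambda>n x. F n (restrict (\<lambda>i. hartley L x i) (K n))"
        "fourier_mode L" "\<lambda>_. borel"]
    by simp
qed

lemma distr_fourier_mode_eq_PiM:
  assumes S: "S \<subseteq> {..L}" and neg: "\<And>m n. m \<in> S \<Longrightarrow> n \<in> S \<Longrightarrow> m \<noteq> n \<Longrightarrow> m \<noteq> neg_index L n"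
  shows "distr (fluct_distr L \<sigma>b \<sigma>w) (\<Pi>\<^sub>M n\<in>S. borel) (\<lambda>x. \<lambda>n\<in>S. fourier_mode L n x)
    = (\<Pi>\<^sub>M n\<in>S. distr (fluct_distr L \<sigma>b \<sigma>w) borel (fourier_mode L n))"
proof (cases "S = {}")
  \<comment> \<open>The equivalence of independence with a product law is applied only to nonempty
    \<open>S\<close>. Here both sides are the unit mass on the single point of the empty
    product.\<close>
  case True
  show ?thesis
    unfolding True
  proof (rule measure_eqI)
    fix A :: "(nat \<Rightarrow> complex) set"
    assume "A \<in> sets (distr (fluct_distr L \<sigma>b \<sigma>w) (\<Pi>\<^sub>M n\<in>{}. borel) (\<lambda>x. \<lambda>n\<in>{}. fourier_mode L n x))"
    then consider "A = {}" | "A = {\<lambda>_. undefined}"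
      by (auto simp: sets_PiM_empty)
    then show "emeasure (distr (fluct_distr L \<sigma>b \<sigma>w) (\<Pi>\<^sub>M n\<in>{}. borel) (\<lambda>x. \<lambda>n\<in>{}. fourier_mode L n x)) A
        = emeasure (\<Pi>\<^sub>M n\<in>{}. distr (fluct_distr L \<sigma>b \<sigma>w) borel (fourier_mode L n)) A"
    proof cases
      case 2
      have "(\<lambda>x. \<lambda>n\<in>{}. fourier_mode L n x) -` A \<inter> space (fluct_distr L \<sigma>b \<sigma>w) = space (fluct_distr L \<sigma>b \<sigma>w)"
        by (auto simp: 2 restrict_def)
      moreover have "(\<lambda>x. \<lambda>n\<in>{}. fourier_mode L n x)
          \<in> fluct_distr L \<sigma>b \<sigma>w \<rightarrow>\<^sub>M (\<Pi>\<^sub>M n\<in>{}. (borel :: complex measure))"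
        by (rule measurable_restrict) simp
      ultimately show ?thesis
        by (simp add: emeasure_distr sets_PiM_empty 2) (simp add: PiM_empty emeasure_space_1)
    qed simp
  qed (simp add: sets_PiM_empty)
next
  case False
  have "indep_vars (\<lambda>_. borel) (fourier_mode L) S"
    using S neg by (rule indep_vars_fourier_mode)
  then show ?thesis
    using False by (subst (asm) indep_vars_iff_distr_eq_PiM) (simp_all add: fourier_mode_measurable)
qed

end

text \<open>Independence up to the reality constraint is expressed by sets \<open>S\<close> with at
  most one index from each reflected pair; self-reflected indices may belong to \<open>S\<close>.
  Integrability and positivity of \<open>partition_fun\<close> ensure that the normalisation is a
  genuine integral and not a default value.\<close>

theorem mainTheorem5:
  fixes L :: nat and \<sigma>b \<sigma>w :: real
  assumes "0 < \<sigma>b\<^sup>2" and "0 < \<sigma>w\<^sup>2" and "\<sigma>w\<^sup>2 < 1"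
  shows
    "(\<forall>\<epsilon> c. fourier_expansion L \<epsilon> c \<longleftrightarrow> (\<forall>n\<le>L. c n = fourier_mode L n \<epsilon>)) \<and>
     (\<forall>\<epsilon> c. fourier_expansion L \<epsilon> c \<longrightarrow>
        energy L \<sigma>b \<sigma>w \<epsilon> =
          real (L + 1) * Delta_w \<sigma>w / \<sigma>b\<^sup>2 *
          (\<Sum>n\<le>L. ((1 + \<sigma>w ^ 4) - 2 * \<sigma>w\<^sup>2 * cos (wavenumber L n)) * (cmod (c n))\<^sup>2)) \<and>
     integrable (config_lborel L) (\<lambda>\<epsilon>. exp (- energy L \<sigma>b \<sigma>w \<epsilon>)) \<and>
     0 < partition_fun L \<sigma>b \<sigma>w \<and>
     prob_space (fluct_distr L \<sigma>b \<sigma>w) \<and>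
     jointly_gaussian (fluct_distr L \<sigma>b \<sigma>w) {..L} (fourier_mode L) \<and>
     (\<forall>\<epsilon>. \<forall>n\<le>L. fourier_mode L (neg_index L n) \<epsilon> = cnj (fourier_mode L n \<epsilon>)) \<and>
     (\<forall>S\<subseteq>{..L}. (\<forall>m\<in>S. \<forall>n\<in>S. m \<noteq> n \<longrightarrow> m \<noteq> neg_index L n) \<longrightarrow>
        prob_space.indep_vars (fluct_distr L \<sigma>b \<sigma>w) (\<lambda>_. borel) (fourier_mode L) S \<and>
        distr (fluct_distr L \<sigma>b \<sigma>w) (\<Pi>\<^sub>M n\<in>S. borel) (\<lambda>\<epsilon>. \<lambda>n\<in>S. fourier_mode L n \<epsilon>) =
          (\<Pi>\<^sub>M n\<in>S. distr (fluct_distr L \<sigma>b \<sigma>w) borel (fourier_mode L n)))"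
proof (intro conjI allI impI)
  show "fourier_expansion L \<epsilon> c \<longleftrightarrow> (\<forall>n\<le>L. c n = fourier_mode L n \<epsilon>)" for \<epsilon> c
    by (rule fourier_expansion_iff)
  show "energy L \<sigma>b \<sigma>w \<epsilon> = real (L + 1) * Delta_w \<sigma>w / \<sigma>b\<^sup>2 *
      (\<Sum>n\<le>L. ((1 + \<sigma>w ^ 4) - 2 * \<sigma>w\<^sup>2 * cos (wavenumber L n)) * (cmod (c n))\<^sup>2)"
    if "fourier_expansion L \<epsilon> c" for \<epsilon> c
    using that by (rule energy_fourier)
  show "integrable (config_lborel L) (\<lambda>\<epsilon>. exp (- energy L \<sigma>b \<sigma>w \<epsilon>))"
    using has_bochner_integral_exp_minus_energy[OF assms(1,3)] by (rule integrable.intros)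
  show "fourier_mode L (neg_index L n) \<epsilon> = cnj (fourier_mode L n \<epsilon>)" if "n \<le> L" for n \<epsilon>
    using that by (rule fourier_mode_neg_index)
  fix S assume "S \<subseteq> {..L}" and "\<forall>m\<in>S. \<forall>n\<in>S. m \<noteq> n \<longrightarrow> m \<noteq> neg_index L n"
  then show "prob_space.indep_vars (fluct_distr L \<sigma>b \<sigma>w) (\<lambda>_. borel) (fourier_mode L) S"
    and "distr (fluct_distr L \<sigma>b \<sigma>w) (\<Pi>\<^sub>M n\<in>S. borel) (\<lambda>\<epsilon>. \<lambda>n\<in>S. fourier_mode L n \<epsilon>) =
      (\<Pi>\<^sub>M n\<in>S. distr (fluct_distr L \<sigma>b \<sigma>w) borel (fourier_mode L n))"
    by (blast intro: indep_vars_fourier_mode[OF assms(1,3)] distr_fourier_mode_eq_PiM[OF assms(1,3)])+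
qed (rule partition_fun_pos prob_space_fluct_distr jointly_gaussian_fourier_mode; fact assms)+

end
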